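(* Let $y\in\mathbb{R}^n$, $X\in\mathbb{R}^{n\times p}$, and let $B$ be a real matrix with $p$ columns. Let $\Lambda = \{\lambda\ge 0 : X^{\mathsf T}X \succ \lambda B^{\mathsf T}B\}$. Then for every $\lambda\in\Lambda$ the group GMC problem $$\operatorname*{minimize}_{\beta\in\mathbb{R}^p}\ \frac{1}{2n}\|y - X\beta\|_2^2 + \lambda\,\Phi_B(\beta)$$ has a solution $\hat\beta(\lambda)$, this solution is unique, and the map $\lambda\mapsto\hat\beta(\lambda)$ is continuous on $\Lambda$.
   Context: The $p$ coordinates are partitioned into $J$ groups of sizes $p_1,\dots,p_J$ with $\sum_{j=1}^J p_j = p$, and we write $\beta = (\beta_1^{\mathsf T},\dots,\beta_J^{\mathsf T})^{\mathsf T}\in\mathbb{R}^p$ with $\beta_j\in\mathbb{R}^{p_j}$ (similarly for $v\in\mathbb{R}^p$). $K_1,\dots,K_J$ are nonnegative weights. For a real matrix $B$ with $p$ columns, the group GMC (generalized minimax concave) penalty $\Phi_B:\mathbb{R}^p\to\mathbb{R}$ is $$\Phi_B(\beta) = \sum_{j=1}^J K_j\|\beta_j\|_2 - \min_{v\in\mathbb{R}^p}\left\{\sum_{j=1}^J K_j\|v_j\|_2 + \frac{1}{2n}\|B(\beta - v)\|_2^2\right\}.$$ $M\succ N$ means that $M-N$ is positive definite. *)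

theory Defs
  imports "HOL-Analysis.Analysis"
begin

definition positive_definite :: "real^'p^'p \<Rightarrow> bool" where
  "positive_definite A \<longleftrightarrow> transpose A = A \<and> (\<forall>x. x \<noteq> 0 \<longrightarrow> x \<bullet> (A *v x) > 0)"

text \<open>
  The groups are the blocks \<open>G 1, \<dots>, G J\<close> of a partition of the coordinate index type \<open>'p\<close>:
  the subvector \<open>\<beta>\<^sub>j\<close> consists of the coordinates of \<open>\<beta>\<close> in \<open>G j\<close>, and \<open>p\<^sub>j = card (G j)\<close>.
\<close>

definition group_partition :: "nat \<Rightarrow> (nat \<Rightarrow> 'p set) \<Rightarrow> bool" where
  "group_partition J G \<longleftrightarrow> disjoint_family_on G {1..J} \<and> (\<Union>j\<in>{1..J}. G j) = UNIV"

definition group_norm :: "nat \<Rightarrow> (nat \<Rightarrow> 'p set) \<Rightarrow> (nat \<Rightarrow> real) \<Rightarrow> real^'p \<Rightarrow> real" where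
  "group_norm J G K \<beta> = (\<Sum>j=1..J. K j * L2_set (\<lambda>i. \<beta> $ i) (G j))"

text \<open>
  The minimum over \<open>v\<close> is written literally, as the least element of the set of values; the
  library's \<open>Min\<close> is meaningful for finite sets only.
\<close>

definition group_gmc_penalty ::
  "nat \<Rightarrow> nat \<Rightarrow> (nat \<Rightarrow> 'p set) \<Rightarrow> (nat \<Rightarrow> real) \<Rightarrow> real^'p^'m \<Rightarrow> real^'p \<Rightarrow> real" where
  "group_gmc_penalty n J G K B \<beta> =
     group_norm J G K \<beta>
     - (LEAST m. \<exists>v. m = group_norm J G K v + 1 / (2 * real n) * (norm (B *v (\<beta> - v)))\<^sup>2)"

definition group_gmc_objective ::
  "real^'n \<Rightarrow> real^'p^'n \<Rightarrow> nat \<Rightarrow> (nat \<Rightarrow> 'p set) \<Rightarrow> (nat \<Rightarrow> real) \<Rightarrow> real^'p^'m \<Rightarrow>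
     real \<Rightarrow> real^'p \<Rightarrow> real" where
  "group_gmc_objective y X J G K B l \<beta> =
     1 / (2 * real CARD('n)) * (norm (y - X *v \<beta>))\<^sup>2
     + l * group_gmc_penalty CARD('n) J G K B \<beta>"

end

theory Submission
  imports Defs
begin

text \<open>
  Write the objective as \<open>F\<^sub>l = q + l \<Phi>\<close> with \<open>q\<close> the least squares term and \<open>\<Phi> = \<Phi>\<^sub>B\<close>. The inner
  minimum is attained, because its objective is coercive modulo the subspace on which both the
  group norm and \<open>B\<close> vanish. Choosing the inner minimiser at the midpoint of \<open>a\<close> and \<open>b\<close>, the
  parallelogram law gives
  \<open>F\<^sub>l ((a + b) / 2) + Q\<^sub>l (a - b) / (8 n) \<le> (F\<^sub>l a + F\<^sub>l b) / 2\<close> with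
  \<open>Q\<^sub>l x = \<parallel>X x\<parallel>\<^sup>2 - l \<parallel>B x\<parallel>\<^sup>2\<close>, hence uniqueness; existence holds because \<open>X\<close> is injective and
  \<open>\<Phi> \<ge> 0\<close>. Finally \<open>\<Phi>\<close> is Lipschitz and does not depend on \<open>l\<close>, so that comparing the minimisers
  \<open>a\<close>, \<open>b\<close> for \<open>l\<close>, \<open>l'\<close> bounds \<open>Q\<^sub>l (a - b)\<close> by a multiple of \<open>\<bar>l - l'\<bar> \<parallel>a - b\<parallel>\<close>.
\<close>

section \<open>Attained minima, homogeneous functions and the parallelogram law\<close>

lemma continuous_attains_inf_coercive:
  fixes f :: "'a::heine_borel \<Rightarrow> real"
  assumes "closed S" "continuous_on S f" "x0 \<in> S" and bdd: "bounded {x \<in> S. f x \<le> f x0}"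
  shows "\<exists>x\<in>S. \<forall>y\<in>S. f x \<le> f y"
proof -
  have "closed {x \<in> S. f x \<le> f x0}"
    using assms(1,2) by (intro continuous_on_closed_Collect_le continuous_intros)
  with bdd have "compact {x \<in> S. f x \<le> f x0}"
    by (simp add: compact_eq_bounded_closed)
  moreover have "continuous_on {x \<in> S. f x \<le> f x0} f"
    using assms(2) by (rule continuous_on_subset) auto
  ultimately obtain x where x: "x \<in> S" "f x \<le> f x0"
    and min: "\<And>y. y \<in> S \<Longrightarrow> f y \<le> f x0 \<Longrightarrow> f x \<le> f y"
    using continuous_attains_inf[of "{x \<in> S. f x \<le> f x0}" f] \<open>x0 \<in> S\<close> by auto
  show ?thesis
    using x min by (meson linorder_le_cases order.trans)
qed

text \<open>The constant is the minimum of \<open>f\<close> on the compact unit sphere of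
  \<open>S\<close>, carried to all of \<open>S\<close> by homogeneity. Used with
  \<open>d = 1\<close> for the coercivity of the inner problem and with \<open>d = 2\<close> for
  quadratic forms.\<close>

lemma homogeneous_lower_bound:
  fixes f :: "'a::euclidean_space \<Rightarrow> real"
  assumes S: "subspace S" and cont: "continuous_on UNIV f" and d: "d > 0"
    and hom: "\<And>r x. f (r *\<^sub>R x) = \<bar>r\<bar> ^ d * f x"
    and pos: "\<And>x. x \<in> S \<Longrightarrow> x \<noteq> 0 \<Longrightarrow> f x > 0"
  shows "\<exists>e>0. \<forall>x\<in>S. e * norm x ^ d \<le> f x"
proof -
  have zero: "f 0 = 0"
    using hom[of 0 0] d by (auto simp: zero_power)
  have unit: "(1 / norm x) *\<^sub>R x \<in> S \<inter> sphere 0 1" if "x \<in> S" "x \<noteq> 0" for x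
    using that S by (simp add: subspace_scale)
  show ?thesis
  proof (cases "S \<inter> sphere 0 1 = {}")
    \<comment> \<open>Here \<open>S\<close> is the zero subspace, so any positive constant will
      do.\<close>
    case True
    then have "x = 0" if "x \<in> S" for x
      using unit[OF that] by blast
    then have "1 * norm x ^ d \<le> f x" if "x \<in> S" for x
      using zero d that by (metis mult_1 norm_zero order_refl zero_power)
    then show ?thesis
      by (intro exI[of _ 1]) auto
  next
    case False
    have "compact (S \<inter> sphere 0 1)"
      using closed_subspace[OF S] by (intro closed_Int_compact) auto
    moreover have "continuous_on (S \<inter> sphere 0 1) f"
      using cont by (rule continuous_on_subset) auto
    ultimately obtain u where u: "u \<in> S \<inter> sphere 0 1"
      and min: "\<forall>x \<in> S \<inter> sphere 0 1. f u \<le> f x"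
      using continuous_attains_inf[OF _ False] by blast
    have "f u * norm x ^ d \<le> f x" if "x \<in> S" for x
    proof (cases "x = 0")
      case False
      have "f u \<le> f ((1 / norm x) *\<^sub>R x)"
        using min unit[OF that False] by blast
      also have "\<dots> = f x / norm x ^ d"
        by (subst hom) (simp add: power_divide)
      finally show ?thesis
        using False by (simp add: pos_le_divide_eq)
    qed (use zero d in \<open>simp add: zero_power\<close>)
    moreover have "f u > 0"
      using u by (intro pos) auto
    ultimately show ?thesis
      by blast
  qed
qed

lemma norm_midpoint_power2:
  fixes p q :: "'a::real_inner"
  shows "(norm (midpoint p q))\<^sup>2 = ((norm p)\<^sup>2 + (norm q)\<^sup>2) / 2 - (norm (p - q))\<^sup>2 / 4"
  by (simp add: midpoint_def power2_norm_eq_inner inner_simps inner_commute field_simps)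

section \<open>Seminorms on a Euclidean space\<close>

locale seminorm =
  fixes N :: "'a::euclidean_space \<Rightarrow> real"
  assumes triangle: "N (x + y) \<le> N x + N y"
    and scale: "N (r *\<^sub>R x) = \<bar>r\<bar> * N x"
begin

lemma zero: "N 0 = 0"
  using scale[of 0 0] by simp

lemma minus: "N (- x) = N x"
  using scale[of "-1" x] by simp

lemma nonneg: "N x \<ge> 0"
  using triangle[of x "- x"] by (simp add: zero minus)

lemma diff_le: "N x - N y \<le> N (x - y)"
  using triangle[of "x - y" y] by simp

lemma minus_commute: "N (x - y) = N (y - x)"
  using minus[of "x - y"] by simp

lemma sum_le: "N (\<Sum>i\<in>I. g i) \<le> (\<Sum>i\<in>I. N (g i))"
  by (induction I rule: infinite_finite_induct) (auto simp: zero intro: order.trans[OF triangle])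

text \<open>Expansion in the standard basis; the summand \<open>1\<close> keeps the constant
  positive even if \<open>N\<close> vanishes identically.\<close>

lemma bound: "\<exists>L>0. \<forall>x. N x \<le> L * norm x"
proof -
  have "N x \<le> (1 + (\<Sum>b\<in>Basis. N b)) * norm x" for x
  proof -
    have "N x = N (\<Sum>b\<in>Basis. (x \<bullet> b) *\<^sub>R b)"
      by (simp add: euclidean_representation)
    also have "\<dots> \<le> (\<Sum>b\<in>Basis. \<bar>x \<bullet> b\<bar> * N b)"
      using sum_le by (simp flip: scale)
    also have "\<dots> \<le> (\<Sum>b\<in>Basis. norm x * N b)"
      by (intro sum_mono mult_right_mono Basis_le_norm nonneg)
    also have "\<dots> = norm x * (\<Sum>b\<in>Basis. N b)"
      by (simp add: sum_distrib_left)
    finally show ?thesis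
      by (simp add: algebra_simps add_increasing)
  qed
  moreover have "1 + (\<Sum>b\<in>Basis. N b) > 0"
    using sum_nonneg[of Basis N] nonneg by (simp add: add_pos_nonneg)
  ultimately show ?thesis by blast
qed

lemma continuous_of_diff_le:
  fixes f :: "'a \<Rightarrow> real"
  assumes "\<And>x y. f x - f y \<le> r * N (x - y)" "r \<ge> 0"
  shows "continuous_on S f"
proof -
  obtain L where L: "L > 0" "\<And>x. N x \<le> L * norm x"
    using bound by blast
  have "dist (f x) (f y) \<le> (r * L) * dist x y" for x y
  proof -
    have "\<bar>f x - f y\<bar> \<le> r * N (x - y)"
      using assms(1)[of x y] assms(1)[of y x] by (simp add: minus_commute[of y x])
    also have "\<dots> \<le> r * (L * norm (x - y))"
      using L(2) assms(2) by (rule mult_left_mono)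
    finally show ?thesis
      by (simp add: dist_norm mult.assoc)
  qed
  then have "(r * L)-lipschitz_on S f"
    using assms(2) L(1) by (intro lipschitz_onI) auto
  then show ?thesis
    by (rule lipschitz_on_continuous_on)
qed

lemma continuous: "continuous_on S N"
  by (rule continuous_of_diff_le[where r = 1]) (use diff_le in auto)

end

section \<open>The GMC penalty built from a seminorm\<close>

locale gmc = seminorm N for N :: "'a::euclidean_space \<Rightarrow> real" +
  fixes B :: "'a \<Rightarrow> 'b::euclidean_space" and c :: real
  assumes linear_B: "linear B" and c_pos: "c > 0"
begin

definition inner_obj :: "'a \<Rightarrow> 'a \<Rightarrow> real"
  where "inner_obj x v = N v + c * (norm (B (x - v)))\<^sup>2"

definition envelope :: "'a \<Rightarrow> real"
  where "envelope x = (LEAST m. \<exists>v. m = inner_obj x v)"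

definition penalty :: "'a \<Rightarrow> real"
  where "penalty x = N x - envelope x"

lemma continuous_B: "continuous_on S B"
  using linear_B by (rule linear_continuous_on_compose[OF continuous_on_id, simplified])

text \<open>\<open>N\<close> may have a kernel, for instance when some weights are zero, so sublevel
  sets can be unbounded along \<open>W\<close>. On the orthogonal complement \<open>V\<close> of
  \<open>W\<close>, however, \<open>N z + norm (B z)\<close> is a norm, and
  \<open>inner_obj x\<close> is coercive there.\<close>

lemma inner_obj_attains: "\<exists>z. \<forall>v. inner_obj x z \<le> inner_obj x v"
proof -
  define W where "W = {w. N w = 0 \<and> B w = 0}"
  define V where "V = {z. \<forall>w\<in>W. orthogonal w z}"
  have "subspace W"
  proof (rule subspaceI)
    show "u + v \<in> W" if "u \<in> W" "v \<in> W" for u v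
      using that triangle[of u v] nonneg[of "u + v"] linear_B by (simp add: W_def linear_add)
  qed (use linear_B in \<open>auto simp: W_def zero scale linear_0 linear_scale\<close>)
  then have span: "span W = W"
    by (simp add: span_eq_iff)
  have V: "subspace V"
    unfolding V_def by (rule subspace_orthogonal_to_vectors)
  have "\<exists>e>0. \<forall>z\<in>V. e * norm z ^ 1 \<le> N z + norm (B z)"
  proof (rule homogeneous_lower_bound[OF V])
    show "continuous_on UNIV (\<lambda>z. N z + norm (B z))"
      by (intro continuous_intros continuous continuous_B)
    show "N z + norm (B z) > 0" if "z \<in> V" "z \<noteq> 0" for z
    proof -
      have "z \<notin> W"
        using that by (auto simp: V_def orthogonal_self)
      then show ?thesis
        using nonneg[of z] norm_ge_zero[of "B z"] unfolding W_def mem_Collect_eq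
        by (metis add_nonneg_pos add_pos_nonneg norm_eq_zero order_less_le)
    qed
  qed (use linear_B in \<open>auto simp: scale linear_scale algebra_simps\<close>)
  then obtain e where e: "e > 0" "\<And>z. z \<in> V \<Longrightarrow> e * norm z \<le> N z + norm (B z)"
    by auto
  define M where "M = inner_obj x 0"
  have "norm z \<le> (M + (norm (B x) + sqrt (M / c))) / e" if "z \<in> V" "inner_obj x z \<le> M" for z
  proof -
    have le: "N z + c * (norm (B (x - z)))\<^sup>2 \<le> M"
      using that by (simp add: inner_obj_def)
    have "c * (norm (B (x - z)))\<^sup>2 \<ge> 0"
      using c_pos by simp
    with le have 1: "N z \<le> M"
      by linarith
    have "(norm (B (x - z)))\<^sup>2 \<le> M / c"
      using le nonneg[of z] c_pos by (simp add: pos_le_divide_eq mult.commute)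
    then have "norm (B (x - z)) \<le> sqrt (M / c)"
      by (rule real_le_rsqrt)
    moreover have "norm (B z) \<le> norm (B x) + norm (B (x - z))"
      using norm_triangle_ineq4[of "B x" "B (x - z)"] linear_B by (simp add: linear_diff)
    ultimately have "e * norm z \<le> M + (norm (B x) + sqrt (M / c))"
      using e(2)[OF that(1)] 1 by linarith
    then show ?thesis
      using e(1) by (simp add: pos_le_divide_eq mult.commute)
  qed
  then have "bounded {z \<in> V. inner_obj x z \<le> inner_obj x 0}"
    unfolding M_def[symmetric] bounded_iff by blast
  moreover have "continuous_on V (inner_obj x)"
    unfolding inner_obj_def
    by (intro continuous_intros continuous continuous_on_compose2[OF continuous_B]) auto
  ultimately obtain z where z: "\<And>v. v \<in> V \<Longrightarrow> inner_obj x z \<le> inner_obj x v"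
    using continuous_attains_inf_coercive[OF closed_subspace[OF V]] subspace_0[OF V] by blast
  \<comment> \<open>Dropping the component of \<open>v\<close> in \<open>W\<close> changes neither
    \<open>N\<close> nor \<open>B\<close>, so the minimum over \<open>V\<close> is global.\<close>
  have "inner_obj x z \<le> inner_obj x v" for v
  proof -
    obtain w u where w: "w \<in> span W" and u: "\<And>w'. w' \<in> span W \<Longrightarrow> orthogonal u w'"
      and v: "v = w + u"
      using orthogonal_subspace_decomp_exists[of W v] by blast
    have w0: "N w = 0" "B w = 0"
      using w unfolding span by (auto simp: W_def)
    have "u \<in> V"
      using u unfolding span by (simp add: V_def orthogonal_commute)
    then have "inner_obj x z \<le> inner_obj x u"
      by (rule z)
    moreover have "N u \<le> N v"
      using triangle[of v "- w"] w0 by (simp add: v minus)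
    moreover have "B (x - v) = B (x - u)"
      using linear_B w0 by (simp add: v linear_diff linear_add)
    ultimately show ?thesis
      by (simp add: inner_obj_def)
  qed
  then show ?thesis by blast
qed

text \<open>Attainment is what makes \<open>LEAST\<close> on the reals denote the minimum.\<close>

lemma envelope_attained: "\<exists>v. envelope x = inner_obj x v"
  and envelope_le: "envelope x \<le> inner_obj x v"
proof -
  obtain z where z: "\<And>v. inner_obj x z \<le> inner_obj x v"
    using inner_obj_attains by blast
  have "envelope x = inner_obj x z"
    unfolding envelope_def by (rule Least_equality) (use z in auto)
  then show "\<exists>v. envelope x = inner_obj x v" "envelope x \<le> inner_obj x v"
    using z by auto
qed

text \<open>Shifting the inner minimiser for \<open>y\<close> by \<open>x - y\<close> leaves the
  quadratic term unchanged and costs at most \<open>N (x - y)\<close>.\<close>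

lemma envelope_diff_le: "envelope x - envelope y \<le> N (x - y)"
proof -
  obtain v where v: "envelope y = inner_obj y v"
    using envelope_attained by blast
  have "envelope x \<le> inner_obj x (v + (x - y))"
    by (rule envelope_le)
  also have "\<dots> \<le> inner_obj y v + N (x - y)"
    using triangle[of v "x - y"] by (simp add: inner_obj_def)
  finally show ?thesis
    by (simp add: v)
qed

text \<open>The choice \<open>v = x\<close> in the inner problem bounds the envelope by
  \<open>N x\<close>.\<close>

lemma penalty_nonneg: "penalty x \<ge> 0"
  using envelope_le[of x x] linear_B by (simp add: penalty_def inner_obj_def linear_0)

lemma penalty_diff_le: "penalty x - penalty y \<le> 2 * N (x - y)"
  using diff_le[of x y] envelope_diff_le[of y x] by (simp add: penalty_def minus_commute[of y x])

end

section \<open>Penalised least squares: existence, uniqueness, continuity\<close>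

locale gmc_regression = gmc N B c for N :: "'a::euclidean_space \<Rightarrow> real"
    and B :: "'a \<Rightarrow> 'b::euclidean_space" and c +
  fixes A :: "'a \<Rightarrow> 'c::euclidean_space" and y :: 'c
  assumes linear_A: "linear A"
begin

definition objective :: "real \<Rightarrow> 'a \<Rightarrow> real"
  where "objective l x = c * (norm (y - A x))\<^sup>2 + l * penalty x"

text \<open>For matrices, this is the quadratic form of
  \<open>transpose A ** A - l *\<^sub>R (transpose B ** B)\<close>, so that
  \<open>admissible\<close> is \<Lambda>.\<close>

definition gap :: "real \<Rightarrow> 'a \<Rightarrow> real"
  where "gap l x = (norm (A x))\<^sup>2 - l * (norm (B x))\<^sup>2"

definition admissible :: "real set"
  where "admissible = {l. l \<ge> 0 \<and> (\<forall>x. x \<noteq> 0 \<longrightarrow> gap l x > 0)}"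

lemma continuous_A: "continuous_on S A"
  using linear_A by (rule linear_continuous_on_compose[OF continuous_on_id, simplified])

lemma gap_lower_bound:
  assumes "l \<in> admissible"
  shows "\<exists>e>0. \<forall>x. e * (norm x)\<^sup>2 \<le> gap l x"
proof -
  have "\<exists>e>0. \<forall>x\<in>UNIV. e * norm x ^ 2 \<le> gap l x"
  proof (rule homogeneous_lower_bound)
    show "continuous_on UNIV (gap l)"
      unfolding gap_def by (intro continuous_intros continuous_A continuous_B)
    show "gap l (r *\<^sub>R x) = \<bar>r\<bar> ^ 2 * gap l x" for r x
      using linear_A linear_B
      by (simp add: gap_def linear_scale power_mult_distrib algebra_simps)
  qed (use assms in \<open>auto simp: admissible_def\<close>)
  then show ?thesis by simp
qed

lemma objective_midpoint:
  assumes "l \<ge> 0"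
  shows "objective l (midpoint a b) + c / 4 * gap l (a - b) \<le> (objective l a + objective l b) / 2"
proof -
  \<comment> \<open>One \<open>v\<close>, optimal at the midpoint, serves as a competitor at
    \<open>a\<close> and at \<open>b\<close>: the penalty is exact at \<open>m\<close> and bounded
    below at the endpoints.\<close>
  define m where "m = midpoint a b"
  obtain v where v: "envelope m = inner_obj m v"
    using envelope_attained by blast
  have lin: "A m = midpoint (A a) (A b)" "B m = midpoint (B a) (B b)"
    using linear_A linear_B by (simp_all add: m_def midpoint_def linear_add linear_scale)
  have "y - A m = midpoint (y - A a) (y - A b)" "B (m - v) = midpoint (B (a - v)) (B (b - v))"
    using lin linear_B by (simp_all add: linear_diff midpoint_def algebra_simps flip: scaleR_add_left)
  then have "(norm (y - A m))\<^sup>2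
      = ((norm (y - A a))\<^sup>2 + (norm (y - A b))\<^sup>2) / 2 - (norm (A (a - b)))\<^sup>2 / 4"
    and "(norm (B (m - v)))\<^sup>2
      = ((norm (B (a - v)))\<^sup>2 + (norm (B (b - v)))\<^sup>2) / 2 - (norm (B (a - b)))\<^sup>2 / 4"
    using linear_A linear_B
    by (simp_all add: norm_midpoint_power2 linear_diff norm_minus_commute)
  note norms = this
  have "N m \<le> (N a + N b) / 2"
    using triangle[of a b] by (simp add: m_def midpoint_def scale)
  moreover have "N a - penalty a \<le> N v + c * (norm (B (a - v)))\<^sup>2"
      "N b - penalty b \<le> N v + c * (norm (B (b - v)))\<^sup>2"
    using envelope_le by (simp_all add: penalty_def inner_obj_def)
  moreover have "penalty m = N m - N v - c * (norm (B (m - v)))\<^sup>2"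
    by (simp add: penalty_def v inner_obj_def)
  \<comment> \<open>The penalty fails midpoint convexity by at most this \<open>B\<close> term; the
    loss has \<open>c / 4 * (norm (A (a - b)))\<^sup>2\<close> to spare, and the difference is
    \<open>gap\<close>.\<close>
  ultimately have "penalty m \<le> (penalty a + penalty b) / 2 + c / 4 * (norm (B (a - b)))\<^sup>2"
    unfolding norms by (simp add: field_simps)
  then have "l * penalty m \<le> l * ((penalty a + penalty b) / 2 + c / 4 * (norm (B (a - b)))\<^sup>2)"
    using assms by (rule mult_left_mono)
  then show ?thesis
    unfolding m_def[symmetric] objective_def norms gap_def by (simp add: field_simps)
qed

text \<open>Quadratic growth away from a minimiser: the midpoint value is at least the minimum, and
  doubling turns \<open>c / 4\<close> into \<open>c / 2\<close>.\<close>

lemma gap_le_of_minimiser: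
  assumes "l \<ge> 0" and min: "\<And>x. objective l a \<le> objective l x"
  shows "c / 2 * gap l (a - b) \<le> objective l b - objective l a"
  using objective_midpoint[OF assms(1), of a b] min[of "midpoint a b"] by simp

lemma objective_attains:
  assumes l: "l \<in> admissible"
  shows "\<exists>a. \<forall>x. objective l a \<le> objective l x"
proof -
  have l0: "l \<ge> 0"
    using l by (simp add: admissible_def)
  obtain e where e: "e > 0" "\<And>x. e * (norm x)\<^sup>2 \<le> gap l x"
    using gap_lower_bound[OF l] by blast
  define M where "M = objective l 0"
  have "norm x \<le> (norm y + sqrt (M / c)) / sqrt e" if "objective l x \<le> M" for x
  proof -
    have "c * (norm (y - A x))\<^sup>2 \<le> M"
      using that mult_nonneg_nonneg[OF l0 penalty_nonneg[of x]] by (simp add: objective_def)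
    then have "(norm (y - A x))\<^sup>2 \<le> M / c"
      using c_pos by (simp add: pos_le_divide_eq mult.commute)
    then have 1: "norm (y - A x) \<le> sqrt (M / c)"
      by (rule real_le_rsqrt)
    \<comment> \<open>Discarding the \<open>B\<close> term leaves a lower bound for
      \<open>norm (A x)\<close>, so a bounded residual forces a bounded \<open>x\<close>.\<close>
    have "l * (norm (B x))\<^sup>2 \<ge> 0"
      using l0 by simp
    then have "(sqrt e * norm x)\<^sup>2 \<le> (norm (A x))\<^sup>2"
      using e(1) e(2)[of x] by (simp add: gap_def power_mult_distrib)
    then have "sqrt e * norm x \<le> norm (A x)"
      by (rule power2_le_imp_le) simp
    also have "\<dots> \<le> norm y + norm (y - A x)"
      using norm_triangle_ineq4[of y "y - A x"] by simp
    also have "\<dots> \<le> norm y + sqrt (M / c)"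
      using 1 by simp
    finally show ?thesis
      using e(1) by (simp add: pos_le_divide_eq mult.commute)
  qed
  then have "bounded {x \<in> UNIV. objective l x \<le> objective l 0}"
    unfolding M_def[symmetric] bounded_iff by blast
  moreover have "continuous_on UNIV penalty"
    by (rule continuous_of_diff_le[OF penalty_diff_le]) simp
  then have "continuous_on UNIV (objective l)"
    unfolding objective_def by (intro continuous_intros continuous_A)
  ultimately show ?thesis
    using continuous_attains_inf_coercive[of UNIV "objective l" 0] by simp
qed

lemma ex1_is_arg_min:
  assumes l: "l \<in> admissible"
  shows "\<exists>!a. is_arg_min (objective l) (\<lambda>_. True) a"
proof -
  have l0: "l \<ge> 0"
    using l by (simp add: admissible_def)
  have "a = b" if a: "\<And>x. objective l a \<le> objective l x" and b: "\<And>x. objective l b \<le> objective l x"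
    for a b
  proof (rule ccontr)
    assume "a \<noteq> b"
    then have "c / 2 * gap l (a - b) > 0"
      using l c_pos by (simp add: admissible_def)
    then show False
      using gap_le_of_minimiser[OF l0 a, of b] b[of a] by linarith
  qed
  then show ?thesis
    using objective_attains[OF l] by (auto simp: is_arg_min_linorder)
qed

lemma objective_arg_min_le:
  assumes "l \<in> admissible"
  shows "objective l (arg_min (objective l) (\<lambda>_. True)) \<le> objective l x"
  using someI_ex[OF ex1_implies_ex[OF ex1_is_arg_min[OF assms]]]
  by (simp add: arg_min_def is_arg_min_linorder)

text \<open>Quadratic growth is applied at the fixed parameter \<open>l\<close> only, so
  \<open>C\<close> may depend on \<open>l\<close> but not on \<open>l'\<close>; this suffices for
  continuity at \<open>l\<close>.\<close>

lemma dist_arg_min_le: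
  assumes l: "l \<in> admissible"
  shows "\<exists>C>0. \<forall>l'\<in>admissible. dist (arg_min (objective l') (\<lambda>_. True))
    (arg_min (objective l) (\<lambda>_. True)) \<le> C * dist l' l"
proof -
  obtain e where e: "e > 0" "\<And>x. e * (norm x)\<^sup>2 \<le> gap l x"
    using gap_lower_bound[OF l] by blast
  obtain L where L: "L > 0" "\<And>x. N x \<le> L * norm x"
    using bound by blast
  define a where "a = arg_min (objective l) (\<lambda>_. True)"
  have "norm (a - b) \<le> 4 * L / (c * e) * \<bar>l' - l\<bar>"
    if "l' \<in> admissible" and b: "b = arg_min (objective l') (\<lambda>_. True)" for l' b
  proof -
    have "c / 2 * (e * (norm (a - b))\<^sup>2) \<le> c / 2 * gap l (a - b)"
      using e(2) c_pos by (intro mult_left_mono) auto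
    also have "\<dots> \<le> objective l b - objective l a"
      using l objective_arg_min_le[OF l] unfolding a_def
      by (intro gap_le_of_minimiser) (auto simp: admissible_def)
    \<comment> \<open>The loss does not involve the parameter. Optimality of \<open>b\<close> for
      \<open>l'\<close> then removes the difference of the \<open>l'\<close> objectives.\<close>
    also have "\<dots> = objective l' b - objective l' a + (l' - l) * (penalty a - penalty b)"
      by (simp add: objective_def algebra_simps)
    also have "\<dots> \<le> (l' - l) * (penalty a - penalty b)"
      using objective_arg_min_le[OF that(1), of a] unfolding b by simp
    also have "\<dots> \<le> \<bar>l' - l\<bar> * \<bar>penalty a - penalty b\<bar>"
      using abs_ge_self[of "(l' - l) * (penalty a - penalty b)"] by (simp add: abs_mult)
    also have "\<dots> \<le> \<bar>l' - l\<bar> * (2 * (L * norm (a - b)))"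
      using penalty_diff_le[of a b] penalty_diff_le[of b a] L(2)[of "a - b"]
      by (intro mult_left_mono) (auto simp: minus_commute[of b a])
    finally have "norm (a - b) * (c * e * norm (a - b)) \<le> norm (a - b) * (4 * L * \<bar>l' - l\<bar>)"
      by (simp add: power2_eq_square algebra_simps)
    \<comment> \<open>Cancelling one factor \<open>norm (a - b)\<close> turns the quadratic estimate
      into a linear one.\<close>
    then have "c * e * norm (a - b) \<le> 4 * L * \<bar>l' - l\<bar> \<or> a = b"
      by (auto simp: mult_le_cancel_left)
    then show ?thesis
      using c_pos e(1) L(1) by (auto simp: field_simps)
  qed
  moreover have "4 * L / (c * e) > 0"
    using L(1) c_pos e(1) by simp
  ultimately show ?thesis
    unfolding a_def by (metis dist_norm norm_minus_commute real_norm_def)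
qed

lemma continuous_on_arg_min:
  "continuous_on admissible (\<lambda>l. arg_min (objective l) (\<lambda>_. True))"
proof (subst continuous_on_iff, intro ballI allI impI)
  fix l and \<epsilon> :: real assume "l \<in> admissible" "\<epsilon> > 0"
  then obtain C where "C > 0" and C: "\<And>l'. l' \<in> admissible \<Longrightarrow> dist (arg_min (objective l') (\<lambda>_. True))
      (arg_min (objective l) (\<lambda>_. True)) \<le> C * dist l' l"
    using dist_arg_min_le by blast
  with \<open>\<epsilon> > 0\<close> show "\<exists>d>0. \<forall>l'\<in>admissible. dist l' l < d \<longrightarrow>
      dist (arg_min (objective l') (\<lambda>_. True)) (arg_min (objective l) (\<lambda>_. True)) < \<epsilon>"
    by (intro exI[of _ "\<epsilon> / C"]) (fastforce simp: pos_less_divide_eq mult.commute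
        intro: order.strict_trans1)
qed

end

section \<open>The group norm and Gram matrices\<close>

lemma seminorm_group_norm:
  fixes G :: "nat \<Rightarrow> 'p::finite set"
  assumes "\<And>j. j \<in> {1..J} \<Longrightarrow> K j \<ge> 0"
  shows "seminorm (group_norm J G K)"
proof
  show "group_norm J G K (x + y) \<le> group_norm J G K x + group_norm J G K y" for x y
    unfolding group_norm_def sum.distrib[symmetric]
  proof (rule sum_mono)
    fix j assume "j \<in> {1..J}"
    then show "K j * L2_set (\<lambda>i. (x + y) $ i) (G j)
        \<le> K j * L2_set (\<lambda>i. x $ i) (G j) + K j * L2_set (\<lambda>i. y $ i) (G j)"
      using assms L2_set_triangle_ineq[of "\<lambda>i. x $ i" "\<lambda>i. y $ i" "G j"]
      by (simp add: mult_left_mono flip: distrib_left)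
  qed
  have "L2_set (\<lambda>i. (r *\<^sub>R x) $ i) (G j) = \<bar>r\<bar> * L2_set (\<lambda>i. x $ i) (G j)"
    for r and x :: "real^'p" and j
    by (simp add: L2_set_def power_mult_distrib real_sqrt_mult flip: sum_distrib_left)
  then show "group_norm J G K (r *\<^sub>R x) = \<bar>r\<bar> * group_norm J G K x" for r x
    by (simp add: group_norm_def sum_distrib_left algebra_simps)
qed

lemma inner_transpose_mult:
  fixes A :: "real^'p^'n"
  shows "x \<bullet> ((transpose A ** A) *v x) = (norm (A *v x))\<^sup>2"
  by (metis dot_lmul_matrix inner_commute matrix_vector_mul_assoc power2_norm_eq_inner
      transpose_matrix_vector vector_transpose_matrix)

text \<open>Gram matrices are symmetric, so only the condition on the quadratic form
  remains.\<close>

lemma positive_definite_gram_diff_iff: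
  fixes A :: "real^'p^'n" and B :: "real^'p^'m"
  shows "positive_definite (transpose A ** A - l *\<^sub>R (transpose B ** B))
    \<longleftrightarrow> (\<forall>x. x \<noteq> 0 \<longrightarrow> (norm (A *v x))\<^sup>2 - l * (norm (B *v x))\<^sup>2 > 0)"
proof -
  have "transpose (transpose A ** A - l *\<^sub>R (transpose B ** B))
      = transpose (transpose A ** A) - l *\<^sub>R transpose (transpose B ** B)"
    by (simp add: transpose_def vec_eq_iff)
  also have "\<dots> = transpose A ** A - l *\<^sub>R (transpose B ** B)"
    by (simp add: matrix_transpose_mul)
  finally show ?thesis
    by (simp add: positive_definite_def matrix_vector_mult_diff_rdistrib inner_diff_right
        scaleR_matrix_vector_assoc[symmetric] inner_transpose_mult)
qed

theorem theorem2p1: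
  fixes y :: "real^'n" and X :: "real^'p^'n" and B :: "real^'p^'m"
    and J :: nat and G :: "nat \<Rightarrow> 'p set" and K :: "nat \<Rightarrow> real" and \<Lambda> :: "real set"
  assumes "group_partition J G"
    and "\<And>j. j \<in> {1..J} \<Longrightarrow> K j \<ge> 0"
    and "\<Lambda> = {l. l \<ge> 0 \<and> positive_definite (transpose X ** X - l *\<^sub>R (transpose B ** B))}"
  shows "(\<forall>l\<in>\<Lambda>. \<exists>!\<beta>. is_arg_min (group_gmc_objective y X J G K B l) (\<lambda>_. True) \<beta>)
    \<and> continuous_on \<Lambda> (\<lambda>l. arg_min (group_gmc_objective y X J G K B l) (\<lambda>_. True))"
proof -
  \<comment> \<open>The factor \<open>1 / (2 * real CARD('n))\<close> is shared by the loss and the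
    inner problem, which is why a single \<open>c\<close> serves both.\<close>
  interpret gmc_regression "group_norm J G K" "(*v) B" "1 / (2 * real CARD('n))" "(*v) X" y
    using seminorm_group_norm[OF assms(2)]
    by (auto simp: gmc_regression_def gmc_regression_axioms_def gmc_def gmc_axioms_def)
  have "group_gmc_objective y X J G K B = objective"
    by (intro ext) (simp add: group_gmc_objective_def group_gmc_penalty_def objective_def
        penalty_def envelope_def inner_obj_def)
  moreover have "\<Lambda> = admissible"
    by (simp add: assms(3) admissible_def gap_def positive_definite_gram_diff_iff)
  ultimately show ?thesis
    using ex1_is_arg_min continuous_on_arg_min by simp
qed

end
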